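(* Let $G$ be a graph obtained from a clique on at least $2$ vertices by choosing at least two of the clique vertices and attaching to each chosen vertex at least three pendant edges (each leading to a new vertex of degree 1). Then $G$ is strongly non-stackable.
   Context: Cup stacking on a finite connected graph: initially one cup on every vertex; a move takes all $r\ge1$ cups from a vertex $x$ onto a vertex $y\neq x$ that already carries at least one cup and satisfies $d(x,y)=r$ (shortest-path distance). A graph is $t$-stackable if some sequence of moves ends with all cups on $t$; it is strongly non-stackable if it is not $t$-stackable for any vertex $t$. *)

theory Defs
  imports "Graph_Theory.Graph_Theory" "HOL-Library.Disjoint_Sets"
begin

text \<open>Graphs are symmetric digraphs, as in the session Graph_Theory. The shortest-path distance is
  the library's weighted distance with all arc weights equal to 1 (infinite if there is no walk).\<close>

definition graph_dist :: "('a, 'b) pre_digraph \<Rightarrow> 'a \<Rightarrow> 'a \<Rightarrow> ereal" where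
  "graph_dist G x y = wf_digraph.\<mu> G (\<lambda>_. 1) x y"

text \<open>A configuration assigns to each vertex its number of cups.\<close>

definition initial_cups :: "('a, 'b) pre_digraph \<Rightarrow> 'a \<Rightarrow> nat" where
  "initial_cups G = (\<lambda>v. if v \<in> verts G then 1 else 0)"

inductive cup_move :: "('a, 'b) pre_digraph \<Rightarrow> ('a \<Rightarrow> nat) \<Rightarrow> ('a \<Rightarrow> nat) \<Rightarrow> bool"
  for G :: "('a, 'b) pre_digraph" where
  "\<lbrakk>x \<in> verts G; y \<in> verts G; x \<noteq> y; c x \<ge> 1; c y \<ge> 1; graph_dist G x y = ereal (real (c x))\<rbrakk>
    \<Longrightarrow> cup_move G c (c(x := 0, y := c y + c x))"

definition stackable :: "('a, 'b) pre_digraph \<Rightarrow> 'a \<Rightarrow> bool" where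
  "stackable G t \<longleftrightarrow> t \<in> verts G \<and>
    (\<exists>c. (cup_move G)\<^sup>*\<^sup>* (initial_cups G) c \<and> (\<forall>v \<in> verts G. v \<noteq> t \<longrightarrow> c v = 0))"

definition strongly_non_stackable :: "('a, 'b) pre_digraph \<Rightarrow> bool" where
  "strongly_non_stackable G \<longleftrightarrow> (\<forall>t \<in> verts G. \<not> stackable G t)"

text \<open>\<open>L c\<close> is the set of the new leaves attached to the vertex \<open>c \<in> C\<close>. Leaves are genuinely new and of
  degree 1 only if the sets \<open>L c\<close> are pairwise disjoint and disjoint from the vertices of \<open>Q\<close>.\<close>

definition attach_pendants ::
  "'a pair_pre_digraph \<Rightarrow> 'a set \<Rightarrow> ('a \<Rightarrow> 'a set) \<Rightarrow> 'a pair_pre_digraph" where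
  "attach_pendants Q C L =
    \<lparr> pverts = pverts Q \<union> (\<Union>c\<in>C. L c),
      parcs = parcs Q \<union> {(c, l) | c l. c \<in> C \<and> l \<in> L c} \<union> {(l, c) | c l. c \<in> C \<and> l \<in> L c} \<rparr>"

lemma pair_graph_attach_pendants:
  assumes "pair_graph Q" "C \<subseteq> pverts Q"
    and "\<And>c. c \<in> C \<Longrightarrow> finite (L c)" "\<And>c. c \<in> C \<Longrightarrow> L c \<inter> pverts Q = {}"
  shows "pair_graph (attach_pendants Q C L)"
proof -
  interpret pair_graph Q by fact
  let ?G = "attach_pendants Q C L"
  have finC: "finite C" using assms(2) pair_finite_verts by (rule finite_subset)
  have V: "pverts ?G = pverts Q \<union> (\<Union>c\<in>C. L c)"
    and A: "parcs ?G = parcs Q \<union> Sigma C L \<union> (Sigma C L)\<inverse>"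
    by (auto simp: attach_pendants_def)
  have finS: "finite (Sigma C L)" using finC assms(3) by auto
  have wf: "fst e \<in> pverts ?G \<and> snd e \<in> pverts ?G" if "e \<in> parcs ?G" for e
    using that assms(2) unfolding V A by (cases e) (auto dest: in_arcsD1 in_arcsD2)
  have "sym (parcs Q)" using pair_sym_arcs by (simp add: symmetric_def)
  then have "sym (parcs ?G)" unfolding A by (auto simp: sym_def)
  moreover have "fst e \<noteq> snd e" if "e \<in> parcs ?G" for e
    using that assms(2,4) pair_no_loops unfolding A by (cases e) force
  moreover have "finite (pverts ?G)" using finC assms(3) pair_finite_verts unfolding V by auto
  moreover have "finite (parcs ?G)" using finS pair_finite_arcs unfolding A by auto
  ultimately show ?thesis using wf by unfold_locales (auto simp: symmetric_def)
qed

end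

theory Submission
  imports Defs
begin

text \<open>Every vertex is emptied at most once, so a sequence of moves is recorded by a rooted forest:
  \<open>p x\<close> is the vertex onto which \<open>x\<close> was emptied, and the stack moved from \<open>x\<close> had as its size
  \<open>s x\<close> the number of vertices in the subtree of \<open>x\<close>, so that \<open>d(x, p x) = s x\<close>. If all cups end
  on \<open>t\<close>, then \<open>s x \<le> 3\<close> for \<open>x \<noteq> t\<close>, because the diameter is 3. Consider a chosen clique vertex
  \<open>c \<noteq> t\<close>; as distance 3 occurs only between pendant vertices of different clique vertices,
  \<open>s c \<le> 2\<close>. A pendant vertex at \<open>c\<close> with \<open>s = 1\<close> is a child of \<open>c\<close> and forces \<open>s c = 2\<close>; one with
  \<open>s = 2\<close> has \<open>c\<close> as its child and forces \<open>s c = 1\<close>. Hence at most one pendant vertex at \<open>c\<close> other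
  than \<open>t\<close> has \<open>s \<le> 2\<close>, and another one has \<open>s = 3\<close>. Its parent has at least 4 vertices in its
  subtree, so it is \<open>t\<close>, and \<open>t\<close> is a pendant vertex at some \<open>c' \<noteq> c\<close>. The same argument for \<open>c'\<close>
  shows that \<open>t\<close> is not a pendant vertex at \<open>c'\<close>.\<close>

section \<open>Forests recorded by sequences of moves\<close>

text \<open>\<open>D\<close> holds the emptied vertices. Acyclicity is not stated: on finitely many
  vertices the size equation makes \<open>s\<close> grow strictly along \<open>p\<close>.\<close>

definition stacking_forest ::
  "('a, 'b) pre_digraph \<Rightarrow> 'a set \<Rightarrow> ('a \<Rightarrow> 'a) \<Rightarrow> ('a \<Rightarrow> nat) \<Rightarrow> bool" where
  "stacking_forest G D p s \<longleftrightarrow> D \<subseteq> verts G \<and>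
    (\<forall>v \<in> verts G. s v = 1 + (\<Sum>x | x \<in> D \<and> p x = v. s x)) \<and>
    (\<forall>x \<in> D. p x \<in> verts G \<and> graph_dist G x (p x) = ereal (real (s x)))"

text \<open>Induction over the moves: a move from \<open>x\<close> to \<open>y\<close> makes
  \<open>x\<close> a child of \<open>y\<close>. The size of an emptied vertex stays frozen, since a
  move needs a cup at its goal. On the other vertices \<open>s\<close> is the current stack, which
  gives the distance for the next move.\<close>

lemma stacking_forest_of_moves:
  assumes "finite (verts G)" and "(cup_move G)\<^sup>*\<^sup>* (initial_cups G) c"
  shows "\<exists>p s. stacking_forest G {x \<in> verts G. c x = 0} p s \<and>
    (\<forall>v \<in> verts G. c v \<noteq> 0 \<longrightarrow> s v = c v)"
  using assms(2)
proof (induction rule: rtranclp_induct)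
  case base
  have "{x \<in> verts G. initial_cups G x = 0} = {}" by (auto simp: initial_cups_def)
  then have "stacking_forest G {x \<in> verts G. initial_cups G x = 0} id (\<lambda>_. 1)"
    by (auto simp: stacking_forest_def)
  moreover have "\<forall>v \<in> verts G. 1 = initial_cups G v" by (simp add: initial_cups_def)
  ultimately show ?case by blast
next
  case (step c c')
  then obtain p s where
    sf: "stacking_forest G {x \<in> verts G. c x = 0} p s" and
    live: "\<And>v. v \<in> verts G \<Longrightarrow> c v \<noteq> 0 \<Longrightarrow> s v = c v" by blast
  from step.hyps(2) obtain x y where
    c': "c' = c(x := 0, y := c y + c x)" and xy: "x \<in> verts G" "y \<in> verts G" "x \<noteq> y"
    and pos: "c x \<ge> 1" "c y \<ge> 1" and dist: "graph_dist G x y = ereal (real (c x))"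
    by (cases rule: cup_move.cases) auto
  let ?D = "{x \<in> verts G. c x = 0}" and ?D' = "{x \<in> verts G. c' x = 0}"
  let ?p = "p(x := y)" and ?s = "s(y := s y + s x)"
  have D': "?D' = insert x ?D" and notin: "x \<notin> ?D" "y \<notin> ?D" using xy pos by (auto simp: c')
  have "?s v = 1 + (\<Sum>z | z \<in> ?D' \<and> ?p z = v. ?s z)" if "v \<in> verts G" for v
  proof -
    \<comment> \<open>The children before the move. Neither \<open>x\<close> nor \<open>y\<close> is
      among them, as both still carry cups.\<close>
    define A where "A = {z. z \<in> ?D \<and> p z = v}"
    have sv: "s v = 1 + sum s A" using sf that by (simp add: stacking_forest_def A_def)
    have A: "finite A" "x \<notin> A" "y \<notin> A" using assms(1) notin by (auto simp: A_def)
    have same: "sum ?s A = sum s A" using A(3) by (intro sum.cong) auto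
    show ?thesis
    proof (cases "v = y")
      case True
      then have "{z. z \<in> ?D' \<and> ?p z = v} = insert x A" unfolding D' A_def using notin by auto
      moreover have "sum ?s (insert x A) = s x + sum s A"
        using sum.insert[OF A(1,2), of ?s] same fun_upd_other[OF xy(3)] by metis
      ultimately have "(\<Sum>z | z \<in> ?D' \<and> ?p z = v. ?s z) = s x + sum s A" by (simp only:)
      moreover have "?s v = s v + s x" using True by simp
      ultimately show ?thesis using sv by linarith
    next
      case False
      then have "{z. z \<in> ?D' \<and> ?p z = v} = A" unfolding D' A_def using notin by auto
      then have "(\<Sum>z | z \<in> ?D' \<and> ?p z = v. ?s z) = sum s A" using same by (simp only:)
      then show ?thesis using sv False by simp
    qed
  qed
  moreover have "?p z \<in> verts G \<and> graph_dist G z (?p z) = ereal (real (?s z))" if "z \<in> ?D'" for z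
    using that sf notin xy pos dist live[of x] unfolding D' by (auto simp: stacking_forest_def)
  ultimately have "stacking_forest G ?D' ?p ?s" unfolding stacking_forest_def by blast
  moreover have "\<forall>v \<in> verts G. c' v \<noteq> 0 \<longrightarrow> ?s v = c' v"
    using live xy pos by (auto simp: c')
  ultimately show ?case by blast
qed

lemma stacking_forest_pos: "stacking_forest G D p s \<Longrightarrow> v \<in> verts G \<Longrightarrow> s v \<ge> 1"
  by (simp add: stacking_forest_def)

lemma stacking_forest_children_le:
  assumes "finite (verts G)" "stacking_forest G D p s" "v \<in> verts G"
    and "A \<subseteq> D" "\<And>x. x \<in> A \<Longrightarrow> p x = v"
  shows "1 + sum s A \<le> s v"
proof -
  have "finite D" using assms(1,2) finite_subset by (auto simp: stacking_forest_def)
  then have "sum s A \<le> (\<Sum>x | x \<in> D \<and> p x = v. s x)" using assms(4,5) by (intro sum_mono2) auto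
  then show ?thesis using assms(2,3) by (simp add: stacking_forest_def)
qed

text \<open>Sizes are positive, so children of total size 1 amount to a single child of size
  1.\<close>

lemma stacking_forest_two_child:
  assumes "stacking_forest G D p s" "v \<in> verts G" "s v = 2"
  obtains x where "x \<in> D" "p x = v" "s x = 1"
proof -
  have "(\<Sum>x | x \<in> D \<and> p x = v. s x) = 1" using assms by (simp add: stacking_forest_def)
  moreover from this obtain x where x: "x \<in> D" "p x = v"
    by (metis (mono_tags, lifting) mem_Collect_eq sum.neutral zero_neq_one)
  \<comment> \<open>A sum over an infinite set would be 0, not 1.\<close>
  moreover have "finite {x. x \<in> D \<and> p x = v}"
    using calculation(1) by (rule_tac ccontr) simp
  ultimately have "s x \<le> 1" by (metis (mono_tags, lifting) mem_Collect_eq member_le_sum zero_le)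
  moreover have "s x \<ge> 1" using x assms(1) by (intro stacking_forest_pos) (auto simp: stacking_forest_def)
  ultimately show thesis using x that by simp
qed

section \<open>Unit-weight distance and walk length\<close>

context pair_wf_digraph
begin

lemma awalk_cost_unit: "awalk_cost (\<lambda>_. 1) w = real (length w)"
  by (induction w) auto

lemma graph_dist_le_length:
  assumes "awalk x w y"
  shows "graph_dist (with_proj G) x y \<le> ereal (real (length w))"
  using min_cost_le_walk_cost[OF assms, of "\<lambda>_. 1"]
  by (simp add: graph_dist_def awalk_cost_unit)

text \<open>Without the arc every walk has length at least 2, and so has their infimum.\<close>

lemma graph_dist_1_imp_arc:
  assumes "graph_dist (with_proj G) x y = 1"
  shows "(x, y) \<in> parcs G"
proof (rule ccontr)
  assume no: "(x, y) \<notin> parcs G"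
  have "2 \<le> length w" if w: "awalk x w y" for w
  proof (cases w)
    \<comment> \<open>An empty walk would give distance at most 0.\<close>
    case Nil
    then show ?thesis using graph_dist_le_length[OF w] assms by simp
  next
    case (Cons e es)
    then show ?thesis using w no by (cases es) (auto simp: awalk_simps)
  qed
  then have "ereal 2 \<le> ereal (awalk_cost (\<lambda>_. 1) w)" if "awalk x w y" for w
    using that by (simp add: awalk_cost_unit numeral_le_real_of_nat_iff)
  then have "ereal 2 \<le> graph_dist (with_proj G) x y"
    unfolding graph_dist_def \<mu>_def by (intro INF_greatest) blast
  then show False using assms by simp
qed

end

section \<open>Distances in a clique with pendant vertices\<close>

locale pendant_clique =
  fixes Q :: "'a pair_pre_digraph" and C :: "'a set" and L :: "'a \<Rightarrow> 'a set" and n :: nat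
  assumes complete: "complete_digraph n (with_proj Q)"
    and chosen: "C \<subseteq> pverts Q"
    and fin_leaves: "\<And>c. c \<in> C \<Longrightarrow> finite (L c)"
    and new_leaves: "\<And>c. c \<in> C \<Longrightarrow> L c \<inter> pverts Q = {}"
    and disj: "disjoint_family_on L C"
begin

abbreviation "H \<equiv> attach_pendants Q C L"

sublocale H: pair_graph H
  using complete chosen fin_leaves new_leaves
  by (intro pair_graph_attach_pendants pair_graphI_complete)

lemma leaf_unique: "c \<in> C \<Longrightarrow> c' \<in> C \<Longrightarrow> l \<in> L c \<Longrightarrow> l \<in> L c' \<Longrightarrow> c = c'"
  using disj by (auto simp: disjoint_family_on_def)

lemma clique_arcs: "parcs Q = {(u, v). u \<in> pverts Q \<and> v \<in> pverts Q \<and> u \<noteq> v}"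
  using complete by (auto simp: complete_digraph_pair_def)

lemma arcs_H: "(u, v) \<in> parcs H \<longleftrightarrow>
    u \<in> pverts Q \<and> v \<in> pverts Q \<and> u \<noteq> v \<or> (u \<in> C \<and> v \<in> L u) \<or> (v \<in> C \<and> u \<in> L v)"
  by (auto simp: attach_pendants_def clique_arcs)

lemma verts_H: "pverts H = pverts Q \<union> (\<Union>c\<in>C. L c)"
  by (simp add: attach_pendants_def)

lemma leaf_neighbour:
  assumes "c \<in> C" "l \<in> L c" and "(l, x) \<in> parcs H \<or> (x, l) \<in> parcs H"
  shows "x = c"
proof -
  have "l \<notin> pverts Q" "l \<notin> C" using assms(1,2) new_leaves chosen by blast+
  then show ?thesis using assms leaf_unique[of c x l] by (auto simp: arcs_H)
qed

lemma walk_between_clique: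
  assumes "u \<in> pverts Q" "v \<in> pverts Q"
  shows "\<exists>w. H.awalk u w v \<and> length w \<le> 1"
proof (cases "u = v")
  case True
  then show ?thesis using assms by (intro exI[of _ "[]"]) (simp add: H.awalk_simps verts_H)
next
  case False
  then show ?thesis using assms
    by (intro exI[of _ "[(u, v)]"]) (simp add: H.awalk_simps verts_H arcs_H)
qed

lemma walk_to_clique:
  assumes "x \<in> pverts H" "v \<in> pverts Q"
  shows "\<exists>w. H.awalk x w v \<and> length w \<le> 2"
proof (cases "x \<in> pverts Q")
  case True
  then show ?thesis using walk_between_clique[OF True assms(2)] by force
next
  case False
  then obtain c where c: "c \<in> C" "x \<in> L c" using assms by (auto simp: verts_H)
  then obtain w where "H.awalk c w v" "length w \<le> 1"
    using walk_between_clique[of c v] assms chosen by auto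
  then show ?thesis using c
    by (intro exI[of _ "(x, c) # w"]) (simp add: H.awalk_simps arcs_H)
qed

lemma walk_via_base:
  assumes "c \<in> C" "l \<in> L c" "H.awalk x w c"
  shows "H.awalk x (w @ [(c, l)]) l"
  using assms by (auto intro!: H.awalk_appendI[of _ _ c] simp: H.awalk_simps arcs_H verts_H)

lemma dist_le_3:
  assumes "x \<in> pverts H" "y \<in> pverts H" "graph_dist (with_proj H) x y = ereal (real k)"
  shows "k \<le> 3"
proof -
  have "\<exists>w. H.awalk x w y \<and> length w \<le> 3"
  proof (cases "y \<in> pverts Q")
    case True
    then show ?thesis using walk_to_clique[OF assms(1) True] by force
  next
    case False
    then obtain c where c: "c \<in> C" "y \<in> L c" using assms by (auto simp: verts_H)
    then obtain w where "H.awalk x w c" "length w \<le> 2"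
      using walk_to_clique[of x c] assms chosen by auto
    then show ?thesis using walk_via_base[OF c, of x w]
      by (intro exI[of _ "w @ [(c, y)]"]) simp
  qed
  then obtain w where w: "H.awalk x w y" "length w \<le> 3" by blast
  show ?thesis using H.graph_dist_le_length[OF w(1)] w(2) assms(3) by simp
qed

text \<open>In every other case a walk of length at most 2 exists: through the clique if
  \<open>x\<close> or \<open>y\<close> lies in it, through the common base if both are pendant
  there.\<close>

lemma dist_3_leaves:
  assumes "x \<in> pverts H" "y \<in> pverts H" "graph_dist (with_proj H) x y = 3"
  obtains c c' where "c \<in> C" "c' \<in> C" "c \<noteq> c'" "x \<in> L c" "y \<in> L c'"
proof -
  have far: "length w \<ge> 3" if "H.awalk x w y" for w
  proof -
    have "ereal 3 \<le> ereal (real (length w))"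
      using H.graph_dist_le_length[OF that] assms(3) by simp
    then show ?thesis by (simp del: ereal_less_eq add: ereal_less_eq(3))
  qed
  have "y \<notin> pverts Q" using walk_to_clique[OF assms(1)] far by fastforce
  then obtain c' where c': "c' \<in> C" "y \<in> L c'" using assms by (auto simp: verts_H)
  \<comment> \<open>The arc from \<open>c'\<close> to \<open>y\<close> prolongs such a walk by
    one.\<close>
  have far': "length w \<ge> 2" if "H.awalk x w c'" for w
    using far[OF walk_via_base[OF c' that]] by simp
  have "x \<notin> pverts Q" using walk_between_clique[of x c'] far' chosen c' by fastforce
  then obtain c where c: "c \<in> C" "x \<in> L c" using assms by (auto simp: verts_H)
  have "c \<noteq> c'"
  proof
    assume "c = c'"
    then have "H.awalk x [(x, c')] c'" using c chosen by (auto simp: H.awalk_simps arcs_H verts_H)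
    then show False using far' by fastforce
  qed
  then show thesis using c c' that by blast
qed

section \<open>Sizes around one chosen clique vertex\<close>

text \<open>Stated for a single \<open>c\<close>, so that it can be applied again to the base of
  \<open>t\<close> that it yields.\<close>

lemma target_is_leaf_elsewhere:
  assumes sf: "stacking_forest (with_proj H) D p s" and D: "pverts H - {t} \<subseteq> D"
    and c: "c \<in> C" "c \<noteq> t" and three: "card (L c) \<ge> 3"
  shows "\<exists>c' \<in> C. c' \<noteq> c \<and> t \<in> L c'"
proof -
  have V: "x \<in> pverts H" if "x \<in> D" for x
    using sf that by (auto simp: stacking_forest_def)
  have p: "p x \<in> pverts H" and d: "graph_dist (with_proj H) x (p x) = ereal (real (s x))"
    if "x \<in> D" for x
    using sf that by (auto simp: stacking_forest_def)
  have pos: "s x \<ge> 1" if "x \<in> D" for x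
    using stacking_forest_pos[OF sf] V[OF that] by simp
  have le3: "s x \<le> 3" if "x \<in> D" for x
    using dist_le_3[OF V p d] that by blast
  have three_leaf: "\<exists>b b'. b \<in> C \<and> b' \<in> C \<and> b \<noteq> b' \<and> x \<in> L b \<and> p x \<in> L b'"
    if "x \<in> D" "s x = 3" for x
    using dist_3_leaves[OF V p, of x x] d[of x] that by (metis numeral_eq_ereal of_nat_numeral)
  have children: "1 + sum s A \<le> s v" if "v \<in> pverts H" "A \<subseteq> D" "\<And>x. x \<in> A \<Longrightarrow> p x = v" for v A
    using stacking_forest_children_le[OF _ sf, of v A] that H.pair_finite_verts by simp
  have cV: "c \<in> pverts H" using c chosen by (auto simp: verts_H)
  then have cD: "c \<in> D" using c D by auto
  have "s c \<noteq> 3" using three_leaf[OF cD] new_leaves chosen c by blast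
  with le3[OF cD] have sc: "s c \<le> 2" by simp
  have LD: "L c - {t} \<subseteq> D" using c D by (auto simp: verts_H)
  have one: "p l = c" if "l \<in> L c - {t}" "s l = 1" for l
  proof -
    have "(l, p l) \<in> parcs H"
      using d[of l] that LD by (intro H.graph_dist_1_imp_arc) (auto simp: one_ereal_def)
    then show ?thesis using leaf_neighbour[of c l "p l"] c that by auto
  qed
  have two: "p c = l \<and> s c = 1" if l: "l \<in> L c - {t}" "s l = 2" for l
  proof -
    have "l \<in> verts (with_proj H)" using l LD V by auto
    then obtain y where y: "y \<in> D" "p y = l" "s y = 1"
      using stacking_forest_two_child[OF sf] l by blast
    have "(y, l) \<in> parcs H"
      using d[of y] y by (intro H.graph_dist_1_imp_arc) (auto simp: one_ereal_def)
    then have "y = c" using leaf_neighbour[of c l y] c l by auto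
    then show ?thesis using y by simp
  qed
  have uniq: "l = l'" if l: "l \<in> L c - {t}" "s l \<le> 2" and l': "l' \<in> L c - {t}" "s l' \<le> 2" for l l'
  proof (rule ccontr)
    assume ne: "l \<noteq> l'"
    have "s l = 1 \<or> s l = 2" "s l' = 1 \<or> s l' = 2"
      using l l' LD pos[of l] pos[of l'] by auto
    then consider "s l = 1" "s l' = 1" | "s l = 1" "s l' = 2" | "s l = 2" "s l' = 1" | "s l = 2" "s l' = 2"
      by blast
    then show False
    \<comment> \<open>Two children of size 1 give \<open>s c \<ge> 3\<close>; one child of size 1
      gives \<open>s c \<ge> 2\<close>, against \<open>s c = 1\<close>; two pendant vertices of size
      2 would both be \<open>p c\<close>.\<close>
    proof cases
      case 1
      then show ?thesis using children[OF cV, of "{l, l'}"] one l l' LD ne sc by auto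
    next
      case 2
      then show ?thesis using children[OF cV, of "{l}"] one two[OF l'(1)] l LD by auto
    next
      case 3
      then show ?thesis using children[OF cV, of "{l'}"] one two[OF l(1)] l' LD by auto
    next
      case 4
      then show ?thesis using two l l' ne by metis
    qed
  qed
  have "\<exists>l \<in> L c - {t}. s l = 3"
  proof (rule ccontr)
    assume "\<not> ?thesis"
    then have "s l \<le> 2" if "l \<in> L c - {t}" for l
      using le3[of l] LD that by force
    then have "card (L c - {t}) \<le> 1"
      using uniq fin_leaves[OF c(1)] by (auto simp: card_le_Suc0_iff_eq)
    \<comment> \<open>At least two of the three pendant vertices remain after removing
      \<open>t\<close>.\<close>
    then show False using three fin_leaves[OF c(1)] by (simp add: card_Diff_singleton_if split: if_splits)
  qed
  then obtain l where l: "l \<in> L c - {t}" "s l = 3" by blast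
  then have lD: "l \<in> D" using LD by blast
  obtain b b' where b: "b \<in> C" "b' \<in> C" "b \<noteq> b'" "l \<in> L b" "p l \<in> L b'"
    using three_leaf[OF lD l(2)] by blast
  have "b = c" using leaf_unique b l c by blast
  moreover have "p l = t"
  proof (rule ccontr)
    assume "p l \<noteq> t"
    then have "p l \<in> D" using p[OF lD] D by auto
    \<comment> \<open>The child \<open>l\<close> alone gives \<open>p l\<close> size at least
      4.\<close>
    then show False using le3 children[OF p[OF lD], of "{l}"] lD l by fastforce
  qed
  ultimately show ?thesis using b by auto
qed

end

theorem theorem4p6:
  fixes Q :: "'a pair_pre_digraph" and C :: "'a set" and L :: "'a \<Rightarrow> 'a set" and n :: nat
  assumes "complete_digraph n (with_proj Q)" and "n \<ge> 2"
    and "C \<subseteq> pverts Q" and "card C \<ge> 2"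
    and "\<And>c. c \<in> C \<Longrightarrow> finite (L c) \<and> card (L c) \<ge> 3"
    and "\<And>c. c \<in> C \<Longrightarrow> L c \<inter> pverts Q = {}"
    and "disjoint_family_on L C"
  shows "strongly_non_stackable (with_proj (attach_pendants Q C L))"
proof -
  interpret pendant_clique Q C L n using assms by unfold_locales auto
  have False if "stackable (with_proj H) t" for t
  proof -
    from that obtain c where moves: "(cup_move (with_proj H))\<^sup>*\<^sup>* (initial_cups (with_proj H)) c"
      and final: "\<And>v. v \<in> pverts H \<Longrightarrow> v \<noteq> t \<Longrightarrow> c v = 0"
      by (auto simp: stackable_def)
    obtain p s where sf: "stacking_forest (with_proj H) {x \<in> pverts H. c x = 0} p s"
      using stacking_forest_of_moves[OF _ moves] H.pair_finite_verts by auto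
    have elsewhere: "\<exists>b' \<in> C. b' \<noteq> b \<and> t \<in> L b'" if "b \<in> C" "b \<noteq> t" for b
      using target_is_leaf_elsewhere[OF sf _ that] final assms(5)[OF that(1)] by auto
    have "\<not> C \<subseteq> {t}" using assms(4) card_mono[of "{t}" C] by auto
    then obtain b where "b \<in> C" "b \<noteq> t" by blast
    then obtain b' where b': "b' \<in> C" "t \<in> L b'" using elsewhere by blast
    \<comment> \<open>Since \<open>t\<close> is pendant, it differs from its base \<open>b'\<close>;
      a second application then hangs \<open>t\<close> on another base, against
      disjointness.\<close>
    then have "b' \<noteq> t" using assms(3,6) by blast
    then show False using elsewhere[OF b'(1)] leaf_unique b' by blast
  qed
  then show ?thesis by (auto simp: strongly_non_stackable_def)
qed

end
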